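(* Let $\lambda$ be a partition and $\mathcal{R}=\{(\mu_a^{\eta_a})\}_{a=1}^{p}$ be a dominant sequence of rectangular shape partitions. Then $$\sum_{N \ge 0} K_{N \lambda, N \mathcal{R}}(q)\,t^N = \frac{P_{\lambda,\mathcal{R}}(q,t)}{Q_{\lambda, \mathcal{R}}(q,t)},$$ where $P_{\lambda,\mathcal{R}}(q,t)$ is a polynomial such that $P_{\lambda,\mathcal{R}}(0,0)=1$, and $Q_{\lambda, \mathcal{R}}(q,t) = \prod_{s \in S} (1- q^{s} t)$ for some finite set of non-negative integers $S:=S(\lambda,\mathcal{R})$ depending on the data $\lambda$ and $\mathcal{R}$.
   Context: Here $K_{\lambda,\mathcal{R}}(q)$ denotes the parabolic Kostka polynomial associated with a partition $\lambda$ and a dominant sequence $\mathcal{R}$ of rectangular shape partitions $(\mu_a^{\eta_a})$ with $|\lambda|=\sum_a \mu_a\eta_a$ (when all $\eta_a=1$ it reduces to the Kostka–Foulkes polynomial $K_{\lambda,\mu}(q)$). Stretching: $N\lambda=(N\lambda_1,N\lambda_2,\ldots)$, and $N\mathcal{R}$ is the sequence of rectangles $((N\mu_a)^{\eta_a})$ obtained by multiplying each row length by $N$ (e.g. $N(1,1)^{n+1}$ means $n+1$ copies of the rectangle $(N,N)$).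
   Formalization: S is taken as a finite multiset, so factors (1 - q^s t) may repeat; with a set of distinct s the claim fails, e.g. for λ=(3,2,1) and the one-row rectangles (2),(2),(1),(1). *)

theory Defs
  imports
    "HOL-Combinatorics.Permutations"
    "HOL-Computational_Algebra.Computational_Algebra"
    "HOL-Library.Multiset"
begin

text \<open>
  Everything is indexed from 0: the parts of a partition \<open>l\<close> are \<open>l 0 \<ge> l 1 \<ge> \<dots>\<close>.
\<close>

definition is_partition :: "(nat \<Rightarrow> nat) \<Rightarrow> bool" where
  "is_partition l \<longleftrightarrow> antimono l \<and> finite {i. l i \<noteq> 0}"

definition partition_size :: "(nat \<Rightarrow> nat) \<Rightarrow> nat" where
  "partition_size l = (\<Sum>i | l i \<noteq> 0. l i)"

definition stretch_partition :: "nat \<Rightarrow> (nat \<Rightarrow> nat) \<Rightarrow> nat \<Rightarrow> nat" where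
  "stretch_partition N l = (\<lambda>i. N * l i)"

text \<open>
  A pair \<open>(\<mu>, \<eta>)\<close> stands for the rectangle with \<open>\<eta>\<close> rows of length \<open>\<mu>\<close>. Dominance of a
  sequence of rectangles means that the concatenation of their rows is weakly decreasing.
\<close>

type_synonym rects = "(nat \<times> nat) list"

definition rect_rows :: "rects \<Rightarrow> nat list" where
  "rect_rows R = concat (map (\<lambda>(\<mu>, \<eta>). replicate \<eta> \<mu>) R)"

definition dominant_rects :: "rects \<Rightarrow> bool" where
  "dominant_rects R \<longleftrightarrow>
     (\<forall>(\<mu>, \<eta>) \<in> set R. 0 < \<mu> \<and> 0 < \<eta>) \<and> sorted_wrt (\<ge>) (rect_rows R)"

definition rects_size :: "rects \<Rightarrow> nat" where
  "rects_size R = (\<Sum>(\<mu>, \<eta>) \<leftarrow> R. \<mu> * \<eta>)"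

definition stretch_rects :: "nat \<Rightarrow> rects \<Rightarrow> rects" where
  "stretch_rects N R = map (\<lambda>(\<mu>, \<eta>). (N * \<mu>, \<eta>)) R"

text \<open>
  For a composition \<open>\<eta>\<close> of \<open>n\<close>, the positive roots \<open>e\<^sub>i - e\<^sub>j\<close> of \<open>GL\<^sub>n\<close> strictly above
  the block diagonal with block sizes \<open>\<eta>\<close>, encoded as pairs \<open>(i, j)\<close>.
\<close>

definition block_roots :: "nat list \<Rightarrow> (nat \<times> nat) set" where
  "block_roots \<eta> =
     {(i, j). \<exists>r \<le> length \<eta>. i < sum_list (take r \<eta>) \<and> sum_list (take r \<eta>) \<le> j \<and> j < sum_list \<eta>}"

text \<open>
  The families \<open>m\<close> of multiplicities with \<open>v = \<Sum> m(i,j) (e\<^sub>i - e\<^sub>j)\<close> in \<open>\<int>\<^sup>n\<close>, the sum being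
  over \<open>(i, j) \<in> \<Phi>\<close>.
\<close>

definition vector_partitions ::
    "nat \<Rightarrow> (nat \<times> nat) set \<Rightarrow> (nat \<Rightarrow> int) \<Rightarrow> (nat \<times> nat \<Rightarrow> nat) set" where
  "vector_partitions n \<Phi> v =
     {m. (\<forall>a. a \<notin> \<Phi> \<longrightarrow> m a = 0) \<and>
         (\<forall>k<n. (\<Sum>(i, j)\<in>\<Phi>. int (m (i, j)) * (of_bool (k = i) - of_bool (k = j))) = v k)}"

text \<open>
  The \<open>q\<close>-analogue of the Kostant partition function, i.e. the coefficient of \<open>x\<^sup>v\<close> in
  \<open>\<Prod> (1 - q x\<^sub>i / x\<^sub>j)\<^sup>-\<^sup>1\<close> over \<open>(i, j) \<in> \<Phi>\<close>. The index set of the sum is finite for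
  \<open>\<Phi> = block_roots \<eta>\<close>, see \<open>finite_vector_partitions\<close> below.
\<close>

definition q_kostant :: "nat \<Rightarrow> (nat \<times> nat) set \<Rightarrow> (nat \<Rightarrow> int) \<Rightarrow> int poly" where
  "q_kostant n \<Phi> v = (\<Sum>m \<in> vector_partitions n \<Phi> v. monom 1 (\<Sum>a\<in>\<Phi>. m a))"

text \<open>
  The parabolic Kostka polynomial
  \<open>K\<^bsub>\<lambda>,R\<^esub>(q) = \<Sum>\<^sub>w sign(w) P\<^sub>\<Phi>(w(\<lambda> + \<delta>) - (\<gamma> + \<delta>); q)\<close>, where \<open>n\<close> is the total number
  of rows of \<open>R\<close>, \<open>w\<close> runs over the symmetric group on \<open>n\<close> letters, \<open>\<gamma>\<close> lists the rows of
  \<open>R\<close>, \<open>\<delta> = (n-1, \<dots>, 1, 0)\<close>, and \<open>P\<^sub>\<Phi>\<close> is the \<open>q\<close>-Kostant partition function for the block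
  roots; equivalently the coefficient of \<open>s\<^sub>\<lambda>(x\<^sub>1, \<dots>, x\<^sub>n)\<close> in
  \<open>\<Sum>\<^sub>w w (x\<^sup>\<gamma> \<Prod>\<^bsub>\<Phi>\<^esub> (1 - q x\<^sub>i/x\<^sub>j)\<^sup>-\<^sup>1 \<Prod>\<^bsub>i<j\<^esub> (1 - x\<^sub>j/x\<^sub>i)\<^sup>-\<^sup>1)\<close>.
  Summing over \<open>w\<close> or over its inverse makes no difference. If \<open>\<lambda>\<close> has more than \<open>n\<close>
  parts (and the size of \<open>R\<close>), the value is 0, because then the vectors \<open>v\<close> below do not
  have coordinate sum 0.
\<close>

definition parabolic_kostka :: "(nat \<Rightarrow> nat) \<Rightarrow> rects \<Rightarrow> int poly" where
  "parabolic_kostka l R =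
     (let \<eta> = map snd R; n = sum_list \<eta>; \<gamma> = rect_rows R; \<delta> = (\<lambda>i. int n - 1 - int i)
      in \<Sum>w | w permutes {..<n}.
           smult (sign w)
             (q_kostant n (block_roots \<eta>)
               (\<lambda>i. (int (l (w i)) + \<delta> (w i)) - (int (\<gamma> ! i) + \<delta> i))))"

lemma block_roots_subset: "block_roots \<eta> \<subseteq> {(i, j). i < j \<and> j < sum_list \<eta>}"
  by (auto simp: block_roots_def)

lemma finite_block_roots: "finite (block_roots \<eta>)"
proof (rule finite_subset)
  show "block_roots \<eta> \<subseteq> {..<sum_list \<eta>} \<times> {..<sum_list \<eta>}"
    using block_roots_subset[of \<eta>] by auto
qed auto

lemma finite_vector_partitions:
  assumes \<Phi>: "\<Phi> \<subseteq> {(i, j). i < j \<and> j < n}"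
  shows "finite (vector_partitions n \<Phi> v)"
proof -
  have fin: "finite \<Phi>"
    by (rule finite_subset[of _ "{..<n} \<times> {..<n}"]) (use \<Phi> in auto)
  define B where "B = - (\<Sum>k<n. int k * v k)"
  have bound: "m a \<le> nat B" if m: "m \<in> vector_partitions n \<Phi> v" and a: "a \<in> \<Phi>" for m a
  proof -
    have "B = - (\<Sum>k<n. int k * (\<Sum>(i, j)\<in>\<Phi>. int (m (i, j)) * (of_bool (k = i) - of_bool (k = j))))"
      using m by (simp add: B_def vector_partitions_def)
    also have "\<dots> = - (\<Sum>(i, j)\<in>\<Phi>. \<Sum>k<n. int k * (int (m (i, j)) * (of_bool (k = i) - of_bool (k = j))))"
      by (simp add: sum_distrib_left case_prod_unfold) (rule sum.swap)
    also have "\<dots> = - (\<Sum>(i, j)\<in>\<Phi>. int (m (i, j)) * (int i - int j))"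
    proof (intro arg_cong[of _ _ uminus] sum.cong refl, clarify)
      fix i j assume "(i, j) \<in> \<Phi>"
      then have "i < n" "j < n" using \<Phi> by auto
      have "(\<Sum>k<n. int k * (int (m (i, j)) * (of_bool (k = i) - of_bool (k = j))))
          = (\<Sum>k<n. (if k = i then int (m (i, j)) * int k else 0)
                  - (if k = j then int (m (i, j)) * int k else 0))"
        by (rule sum.cong) auto
      also have "\<dots> = int (m (i, j)) * (int i - int j)"
        using \<open>i < n\<close> \<open>j < n\<close> by (simp add: sum_subtractf sum.delta right_diff_distrib)
      finally show "(\<Sum>k<n. int k * (int (m (i, j)) * (of_bool (k = i) - of_bool (k = j))))
          = int (m (i, j)) * (int i - int j)" .
    qed
    also have "\<dots> = (\<Sum>(i, j)\<in>\<Phi>. int (m (i, j)) * (int j - int i))"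
      by (simp add: sum_negf[symmetric] case_prod_unfold algebra_simps)
    finally have B: "B = (\<Sum>b\<in>\<Phi>. int (m b) * (int (snd b) - int (fst b)))"
      by (simp add: case_prod_unfold)
    have "int (m a) * 1 \<le> int (m a) * (int (snd a) - int (fst a))"
      using \<Phi> a by (intro mult_left_mono) auto
    also have "\<dots> \<le> B"
      unfolding B by (rule member_le_sum[OF a _ fin]) (use \<Phi> in auto)
    finally show ?thesis by linarith
  qed
  have "vector_partitions n \<Phi> v \<subseteq>
      {m. \<forall>a. (a \<in> \<Phi> \<longrightarrow> m a \<in> {..nat B}) \<and> (a \<notin> \<Phi> \<longrightarrow> m a = 0)}"
    using bound by (auto simp: vector_partitions_def)
  then show ?thesis
    by (rule finite_subset) (rule finite_set_of_finite_funs[OF fin], simp)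
qed

end

theory Submission
  imports Defs
begin

text \<open>
  For a set \<open>\<Phi>\<close> of positive roots put \<open>F(\<Phi>, c) = \<Sum>\<^sub>N P\<^sub>\<Phi>(N u + c; q) t\<^sup>N\<close>; the generating function
  of the theorem is a signed sum of such series. Splitting by whether a root \<open>a\<close> occurs gives
  \<open>F(\<Phi>, c) = q F(\<Phi>, c - a) + F(\<Phi> - {a}, c)\<close>. By induction on \<open>\<Phi>\<close> all the series
  \<open>F(\<Phi> - {a}, c)\<close> are rational with denominators of the required form. If \<open>u\<close> itself has a partition
  \<open>g\<close> into roots of \<open>\<Phi>\<close>, removing the parts of \<open>g\<close> one by one gives
  \<open>F(\<Phi>, c) = q\<^bsup>|g|\<^esup> F(\<Phi>, c - u)\<close> modulo such series, and \<open>F(\<Phi>, c - u) = t F(\<Phi>, c)\<close> up to the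
  constant term, which produces the factor \<open>1 - q\<^bsup>|g|\<^esup> t\<close>. If \<open>u\<close> has no partition, the integrality
  of network flows (Hoffman's circulation theorem) shows that \<open>N u + c\<close> has none
  for large \<open>N\<close>, so that \<open>F(\<Phi>, c)\<close> is a polynomial.
\<close>

section \<open>Integral flows with prescribed divergence\<close>

text \<open>Pairs in \<open>\<Phi>\<close> are read as arcs of a directed graph: the sum of
  \<open>m a * root_vector a\<close> is the divergence of the flow \<open>m\<close>.\<close>

definition root_vector :: "nat \<times> nat \<Rightarrow> nat \<Rightarrow> int" where
  "root_vector a k = of_bool (k = fst a) - of_bool (k = snd a)"

text \<open>The share of the arc \<open>a\<close> in the capacity of the cut \<open>X\<close> in
  Hoffman's condition: leaving arcs count with their upper bound, entering arcs with minus their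
  lower bound.\<close>

definition cut_term :: "(nat \<times> nat \<Rightarrow> int) \<Rightarrow> (nat \<times> nat \<Rightarrow> int) \<Rightarrow> nat set \<Rightarrow> nat \<times> nat \<Rightarrow> int" where
  "cut_term lo up X a = of_bool (fst a \<in> X \<and> snd a \<notin> X) * up a - of_bool (snd a \<in> X \<and> fst a \<notin> X) * lo a"

lemma sum_mult_root:
  assumes "fst a < n" "snd a < n"
  shows "(\<Sum>k<n. f k * root_vector a k) = f (fst a) - f (snd a)"
proof -
  have "(\<Sum>k<n. f k * root_vector a k)
      = (\<Sum>k<n. (if k = fst a then f k else 0) - (if k = snd a then f k else 0))"
    by (rule sum.cong) (auto simp: root_vector_def)
  then show ?thesis
    using assms by (simp add: sum_subtractf sum.delta)
qed

text \<open>Summation by parts against a potential \<open>f\<close>. Indicator functions give net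
  outflows of vertex sets; the potential \<open>k\<close> gives heights of roots.\<close>

lemma sum_mult_divergence:
  assumes "\<Phi> \<subseteq> {..<n} \<times> {..<n}"
  shows "(\<Sum>k<n. f k * (\<Sum>a\<in>\<Phi>. m a * root_vector a k)) = (\<Sum>a\<in>\<Phi>. m a * (f (fst a) - f (snd a)))"
proof -
  have "(\<Sum>k<n. f k * (\<Sum>a\<in>\<Phi>. m a * root_vector a k)) = (\<Sum>k<n. \<Sum>a\<in>\<Phi>. m a * (f k * root_vector a k))"
    by (simp add: sum_distrib_left mult.left_commute)
  also have "\<dots> = (\<Sum>a\<in>\<Phi>. \<Sum>k<n. m a * (f k * root_vector a k))"
    by (rule sum.swap)
  also have "\<dots> = (\<Sum>a\<in>\<Phi>. m a * (f (fst a) - f (snd a)))"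
    using assms by (intro sum.cong refl, subst sum_distrib_left[symmetric], subst sum_mult_root) auto
  finally show ?thesis .
qed

lemma sum_divergence:
  assumes "\<Phi> \<subseteq> {..<n} \<times> {..<n}" "X \<subseteq> {..<n}"
  shows "(\<Sum>k\<in>X. \<Sum>a\<in>\<Phi>. m a * root_vector a k)
       = (\<Sum>a\<in>\<Phi>. m a * (of_bool (fst a \<in> X) - of_bool (snd a \<in> X)))"
proof -
  have "(\<Sum>k\<in>X. \<Sum>a\<in>\<Phi>. m a * root_vector a k) = (\<Sum>k<n. of_bool (k \<in> X) * (\<Sum>a\<in>\<Phi>. m a * root_vector a k))"
    using assms(2) by (intro sum.mono_neutral_cong_left) auto
  then show ?thesis
    using sum_mult_divergence[OF assms(1), of "\<lambda>k. of_bool (k \<in> X)" m] by simp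
qed

text \<open>Only arcs joining \<open>X - Y\<close> and \<open>Y - X\<close> make the two sides
  differ, by \<open>up a - lo a\<close>. The loss is recorded in the one direction that uncrossing
  needs.\<close>

lemma cut_term_submodular:
  assumes "lo a \<le> up a"
  shows "cut_term lo up (X \<inter> Y) a + cut_term lo up (X \<union> Y) a
           + of_bool (fst a \<in> X \<and> snd a \<notin> X \<and> snd a \<in> Y \<and> fst a \<notin> Y) * (up a - lo a)
       \<le> cut_term lo up X a + cut_term lo up Y a"
  using assms by (auto simp: cut_term_def)

text \<open>Induction on the total width of the intervals \<open>[lo a, up a]\<close>. While some
  interval is not a point, one of its ends can be moved inwards by 1 without breaking the cut
  condition; unit moves keep the flow integral.\<close>

theorem hoffman_circulation:
  fixes b :: "nat \<Rightarrow> int"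
  assumes \<Phi>: "\<Phi> \<subseteq> {..<n} \<times> {..<n}"
    and "\<And>a. a \<in> \<Phi> \<Longrightarrow> lo a \<le> up a"
    and b: "(\<Sum>k<n. b k) = 0"
    and "\<And>X. X \<subseteq> {..<n} \<Longrightarrow> (\<Sum>k\<in>X. b k) \<le> (\<Sum>a\<in>\<Phi>. cut_term lo up X a)"
  shows "\<exists>f. (\<forall>a\<in>\<Phi>. lo a \<le> f a \<and> f a \<le> up a) \<and> (\<forall>k<n. (\<Sum>a\<in>\<Phi>. f a * root_vector a k) = b k)"
  using assms(2,4)
proof (induction "nat (\<Sum>a\<in>\<Phi>. up a - lo a)" arbitrary: lo up rule: less_induct)
  case less
  note le = less.prems(1) and cut = less.prems(2)
  have fin: "finite \<Phi>"
    using \<Phi> finite_subset by blast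
  show ?case
  proof (cases "\<forall>a\<in>\<Phi>. lo a = up a")
    case True
    \<comment> \<open>The only candidate flow is \<open>lo\<close>. Singleton cuts bound
      \<open>b\<close> pointwise by its divergence, and both have total 0, so they agree.\<close>
    have "b k \<le> (\<Sum>a\<in>\<Phi>. lo a * root_vector a k)" if "k < n" for k
    proof -
      have "b k \<le> (\<Sum>a\<in>\<Phi>. cut_term lo up {k} a)"
        using cut[of "{k}"] that by simp
      also have "\<dots> = (\<Sum>a\<in>\<Phi>. lo a * root_vector a k)"
        using True by (intro sum.cong) (auto simp: cut_term_def root_vector_def)
      finally show ?thesis .
    qed
    moreover have "(\<Sum>k<n. b k) = (\<Sum>k<n. \<Sum>a\<in>\<Phi>. lo a * root_vector a k)"
      using sum_divergence[OF \<Phi> order_refl, of lo] \<Phi> b by (auto intro!: sum.neutral)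
    ultimately have "(\<Sum>a\<in>\<Phi>. lo a * root_vector a k) = b k" if "k < n" for k
      using sum_mono_inv[of b "{..<n}" "\<lambda>k. \<Sum>a\<in>\<Phi>. lo a * root_vector a k" k] that by simp
    then show ?thesis
      using True by (intro exI[of _ lo]) auto
  next
    case False
    then obtain e where e: "e \<in> \<Phi>" "lo e < up e"
      using le by force
    define up' where "up' = up(e := up e - 1)"
    define lo' where "lo' = lo(e := lo e + 1)"
    have slack: "0 < (\<Sum>a\<in>\<Phi>. up a - lo a)"
      by (rule sum_pos2[OF fin e(1)]) (use e le in auto)
    have "(\<Sum>a\<in>\<Phi>. up' a - lo a) < (\<Sum>a\<in>\<Phi>. up a - lo a)"
      by (rule sum_strict_mono_ex1[OF fin]) (use e in \<open>auto simp: up'_def\<close>)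
    then have less_up: "nat (\<Sum>a\<in>\<Phi>. up' a - lo a) < nat (\<Sum>a\<in>\<Phi>. up a - lo a)"
      using slack by linarith
    have "(\<Sum>a\<in>\<Phi>. up a - lo' a) < (\<Sum>a\<in>\<Phi>. up a - lo a)"
      by (rule sum_strict_mono_ex1[OF fin]) (use e in \<open>auto simp: lo'_def\<close>)
    then have less_lo: "nat (\<Sum>a\<in>\<Phi>. up a - lo' a) < nat (\<Sum>a\<in>\<Phi>. up a - lo a)"
      using slack by linarith
    have cut_up': "(\<Sum>a\<in>\<Phi>. cut_term lo up' X a)
        = (\<Sum>a\<in>\<Phi>. cut_term lo up X a) - of_bool (fst e \<in> X \<and> snd e \<notin> X)" for X
    proof -
      have "(\<Sum>a\<in>\<Phi>. cut_term lo up' X a)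
          = (\<Sum>a\<in>\<Phi>. cut_term lo up X a - (if a = e then of_bool (fst e \<in> X \<and> snd e \<notin> X) else 0))"
        by (rule sum.cong) (auto simp: cut_term_def up'_def)
      then show ?thesis
        using fin e by (simp add: sum_subtractf sum.delta)
    qed
    have cut_lo': "(\<Sum>a\<in>\<Phi>. cut_term lo' up X a)
        = (\<Sum>a\<in>\<Phi>. cut_term lo up X a) - of_bool (snd e \<in> X \<and> fst e \<notin> X)" for X
    proof -
      have "(\<Sum>a\<in>\<Phi>. cut_term lo' up X a)
          = (\<Sum>a\<in>\<Phi>. cut_term lo up X a - (if a = e then of_bool (snd e \<in> X \<and> fst e \<notin> X) else 0))"
        by (rule sum.cong) (auto simp: cut_term_def lo'_def)
      then show ?thesis
        using fin e by (simp add: sum_subtractf sum.delta)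
    qed
    consider
        (up) "\<forall>X\<subseteq>{..<n}. (\<Sum>k\<in>X. b k) \<le> (\<Sum>a\<in>\<Phi>. cut_term lo up' X a)"
      | (lo) "\<forall>X\<subseteq>{..<n}. (\<Sum>k\<in>X. b k) \<le> (\<Sum>a\<in>\<Phi>. cut_term lo' up X a)"
      | (tight) X Y where
          "X \<subseteq> {..<n}" "(\<Sum>a\<in>\<Phi>. cut_term lo up' X a) < (\<Sum>k\<in>X. b k)"
          "Y \<subseteq> {..<n}" "(\<Sum>a\<in>\<Phi>. cut_term lo' up Y a) < (\<Sum>k\<in>Y. b k)"
      by (meson not_le)
    then show ?thesis
    proof cases
      case up
      have "lo a \<le> up' a" if "a \<in> \<Phi>" for a
        using le[OF that] e by (simp add: up'_def)
      with up obtain f where f: "\<forall>a\<in>\<Phi>. lo a \<le> f a \<and> f a \<le> up' a"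
          "\<forall>k<n. (\<Sum>a\<in>\<Phi>. f a * root_vector a k) = b k"
        using less.hyps[OF less_up] by blast
      have "f a \<le> up a" if "a \<in> \<Phi>" for a
        using f(1) that by (force simp: up'_def split: if_splits)
      with f show ?thesis by blast
    next
      case lo
      have "lo' a \<le> up a" if "a \<in> \<Phi>" for a
        using le[OF that] e by (simp add: lo'_def)
      with lo obtain f where f: "\<forall>a\<in>\<Phi>. lo' a \<le> f a \<and> f a \<le> up a"
          "\<forall>k<n. (\<Sum>a\<in>\<Phi>. f a * root_vector a k) = b k"
        using less.hyps[OF less_lo] by blast
      have "lo a \<le> f a" if "a \<in> \<Phi>" for a
        using f(1) that by (force simp: lo'_def split: if_splits)
      with f show ?thesis by blast
    next
      \<comment> \<open>Neither bound at \<open>e\<close> can be tightened, so \<open>X\<close> and \<open>Y\<close> are tight cuts crossed by \<open>e\<close> in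
        opposite directions; uncrossing them loses \<open>up e - lo e > 0\<close>.\<close>
      case tight
      \<comment> \<open>The change at \<open>e\<close> lowers a cut by at most 1, so an integral cut
        inequality that fails afterwards was an equality before.\<close>
      have X: "fst e \<in> X" "snd e \<notin> X" "(\<Sum>a\<in>\<Phi>. cut_term lo up X a) \<le> (\<Sum>k\<in>X. b k)"
        using tight(2) cut[OF tight(1)] by (auto simp: cut_up' of_bool_def split: if_splits)
      have Y: "snd e \<in> Y" "fst e \<notin> Y" "(\<Sum>a\<in>\<Phi>. cut_term lo up Y a) \<le> (\<Sum>k\<in>Y. b k)"
        using tight(4) cut[OF tight(3)] by (auto simp: cut_lo' of_bool_def split: if_splits)
      let ?d = "\<lambda>a. of_bool (fst a \<in> X \<and> snd a \<notin> X \<and> snd a \<in> Y \<and> fst a \<notin> Y) * (up a - lo a)"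
      have "0 < (\<Sum>a\<in>\<Phi>. ?d a)"
        by (rule sum_pos2[OF fin e(1)]) (use e le X Y in auto)
      moreover have "(\<Sum>a\<in>\<Phi>. cut_term lo up (X \<inter> Y) a + cut_term lo up (X \<union> Y) a + ?d a)
          \<le> (\<Sum>a\<in>\<Phi>. cut_term lo up X a + cut_term lo up Y a)"
        by (intro sum_mono cut_term_submodular le)
      moreover have "(\<Sum>k\<in>X. b k) + (\<Sum>k\<in>Y. b k) = (\<Sum>k\<in>X \<inter> Y. b k) + (\<Sum>k\<in>X \<union> Y. b k)"
        using sum.union_inter[of X Y b] tight(1,3) by (simp add: finite_subset)
      moreover have "(\<Sum>k\<in>X \<inter> Y. b k) \<le> (\<Sum>a\<in>\<Phi>. cut_term lo up (X \<inter> Y) a)"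
          "(\<Sum>k\<in>X \<union> Y. b k) \<le> (\<Sum>a\<in>\<Phi>. cut_term lo up (X \<union> Y) a)"
        using tight(1,3) by (auto intro!: cut)
      ultimately have False
        using X(3) Y(3) by (simp add: sum.distrib)
      then show ?thesis ..
    qed
  qed
qed

section \<open>The \<open>q\<close>-Kostant partition function\<close>

lemma mem_vector_partitions_iff:
  "m \<in> vector_partitions n \<Phi> v \<longleftrightarrow>
     (\<forall>a. a \<notin> \<Phi> \<longrightarrow> m a = 0) \<and> (\<forall>k<n. (\<Sum>a\<in>\<Phi>. int (m a) * root_vector a k) = v k)"
  by (simp add: vector_partitions_def root_vector_def case_prod_unfold)

lemma q_kostant_cong:
  assumes "\<And>k. k < n \<Longrightarrow> v k = v' k"
  shows "q_kostant n \<Phi> v = q_kostant n \<Phi> v'"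
proof -
  have "vector_partitions n \<Phi> v = vector_partitions n \<Phi> v'"
    using assms by (auto simp: mem_vector_partitions_iff)
  then show ?thesis by (simp add: q_kostant_def)
qed

lemma sum_fun_upd_int:
  fixes h :: "'a \<Rightarrow> int"
  assumes "finite A" "a \<in> A"
  shows "(\<Sum>x\<in>A. int ((m(a := y)) x) * h x) = (\<Sum>x\<in>A. int (m x) * h x) + (int y - int (m a)) * h a"
proof -
  have "(\<Sum>x\<in>A. int ((m(a := y)) x) * h x)
      = (\<Sum>x\<in>A. int (m x) * h x + (if x = a then (int y - int (m a)) * h a else 0))"
    by (rule sum.cong) (auto simp: algebra_simps)
  then show ?thesis
    using assms by (simp add: sum.distrib)
qed

text \<open>Lowering the multiplicity of \<open>a\<close> by 1 is a bijection from the partitions of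
  \<open>v\<close> that use \<open>a\<close> to the partitions of \<open>v\<close> minus
  \<open>a\<close>; the lost part accounts for the factor \<open>q\<close>.\<close>

lemma q_kostant_remove_root:
  assumes \<Phi>: "\<Phi> \<subseteq> {(i, j). i < j \<and> j < n}" and a: "a \<in> \<Phi>"
  shows "q_kostant n \<Phi> v
       = monom 1 1 * q_kostant n \<Phi> (\<lambda>k. v k - root_vector a k) + q_kostant n (\<Phi> - {a}) v"
proof -
  have fin: "finite \<Phi>"
    by (rule finite_subset[of _ "{..<n} \<times> {..<n}"]) (use \<Phi> in auto)
  let ?V = "vector_partitions n \<Phi> v"
  let ?V' = "vector_partitions n \<Phi> (\<lambda>k. v k - root_vector a k)"
  let ?g = "\<lambda>m. m(a := Suc (m a))"
  let ?w = "\<lambda>m. monom (1::int) (\<Sum>a\<in>\<Phi>. m a)"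
  have finV: "finite ?V"
    by (rule finite_vector_partitions[OF \<Phi>])
  have upd: "(\<Sum>x\<in>\<Phi>. int ((?g m) x) * root_vector x k) = (\<Sum>x\<in>\<Phi>. int (m x) * root_vector x k) + root_vector a k"
    for m :: "nat \<times> nat \<Rightarrow> nat" and k
    by (subst sum_fun_upd_int[OF fin a]) simp
  have pos: "{m \<in> ?V. 0 < m a} = ?g ` ?V'"
  proof (intro equalityI subsetI)
    fix m assume m: "m \<in> {m \<in> ?V. 0 < m a}"
    define m' where "m' = m(a := m a - 1)"
    have "m = ?g m'"
      using m by (auto simp: m'_def)
    moreover have "m' \<in> ?V'"
      using m upd[of m'] a \<open>m = ?g m'\<close>[symmetric]
      by (auto simp: mem_vector_partitions_iff m'_def algebra_simps)
    ultimately show "m \<in> ?g ` ?V'" by blast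
  next
    fix m assume "m \<in> ?g ` ?V'"
    then obtain m' where "m = ?g m'" "m' \<in> ?V'" by blast
    then show "m \<in> {m \<in> ?V. 0 < m a}"
      using a upd[of m'] by (auto simp: mem_vector_partitions_iff)
  qed
  have inj: "inj_on ?g ?V'"
    by (rule inj_onI, rule ext) (metis fun_upd_apply nat.inject)
  have "(\<Sum>x\<in>\<Phi>. (?g m) x) = Suc (\<Sum>x\<in>\<Phi>. m x)" for m :: "nat \<times> nat \<Rightarrow> nat"
    by (simp add: sum.remove[OF fin a])
  then have 1: "(\<Sum>m | m \<in> ?V \<and> 0 < m a. ?w m) = monom 1 1 * q_kostant n \<Phi> (\<lambda>k. v k - root_vector a k)"
    unfolding q_kostant_def sum_distrib_left mult_monom
    by (subst pos, subst sum.reindex[OF inj]) simp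
  have rm: "(\<Sum>x\<in>\<Phi>. int (m x) * root_vector x k) = (\<Sum>x\<in>\<Phi> - {a}. int (m x) * root_vector x k)"
    if "m a = 0" for m k
    using that by (simp add: sum.remove[OF fin a])
  have zero: "{m \<in> ?V. m a = 0} = vector_partitions n (\<Phi> - {a}) v"
    using rm by (auto simp: mem_vector_partitions_iff simp del: split_paired_All)
  have 2: "(\<Sum>m | m \<in> ?V \<and> m a = 0. ?w m) = q_kostant n (\<Phi> - {a}) v"
    unfolding q_kostant_def zero
    by (intro sum.cong refl) (simp add: sum.remove[OF fin a] mem_vector_partitions_iff del: split_paired_All)
  have "q_kostant n \<Phi> v = (\<Sum>m | m \<in> ?V \<and> 0 < m a. ?w m) + (\<Sum>m | m \<in> ?V \<and> m a = 0. ?w m)"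
    unfolding q_kostant_def
    by (subst sum.union_disjoint[symmetric]) (use finV in \<open>auto intro: sum.cong\<close>)
  then show ?thesis unfolding 1 2 .
qed

text \<open>A partition \<open>m\<close> of \<open>N u + c\<close> serves as the capacities of a
  network. Its cut condition for \<open>u\<close> follows because \<open>c\<close> is too small
  compared with \<open>N\<close> to disturb integral inequalities, and an integral flow is then a
  partition of \<open>u\<close>.\<close>

lemma vector_partitions_empty_eventually:
  assumes \<Phi>: "\<Phi> \<subseteq> {(i, j). i < j \<and> j < n}"
    and empty: "vector_partitions n \<Phi> u = {}"
    and N: "1 + (\<Sum>k<n. \<bar>c k\<bar>) \<le> int N"
  shows "vector_partitions n \<Phi> (\<lambda>k. int N * u k + c k) = {}"
proof (rule ccontr)
  assume "\<not> ?thesis"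
  then obtain m where m: "m \<in> vector_partitions n \<Phi> (\<lambda>k. int N * u k + c k)" by blast
  have \<Phi>': "\<Phi> \<subseteq> {..<n} \<times> {..<n}"
    using \<Phi> by auto
  have div: "int N * (\<Sum>k\<in>X. u k) + (\<Sum>k\<in>X. c k)
      = (\<Sum>a\<in>\<Phi>. int (m a) * (of_bool (fst a \<in> X) - of_bool (snd a \<in> X)))"
    if "X \<subseteq> {..<n}" for X
  proof -
    have "int N * (\<Sum>k\<in>X. u k) + (\<Sum>k\<in>X. c k) = (\<Sum>k\<in>X. \<Sum>a\<in>\<Phi>. int (m a) * root_vector a k)"
      unfolding sum_distrib_left sum.distrib[symmetric]
      using m that by (intro sum.cong) (auto simp: mem_vector_partitions_iff)
    then show ?thesis
      using sum_divergence[OF \<Phi>' that] by simp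
  qed
  have c: "\<bar>\<Sum>k\<in>X. c k\<bar> \<le> int N - 1" if "X \<subseteq> {..<n}" for X
  proof -
    have "\<bar>\<Sum>k\<in>X. c k\<bar> \<le> (\<Sum>k\<in>X. \<bar>c k\<bar>)" by (rule sum_abs)
    also have "\<dots> \<le> (\<Sum>k<n. \<bar>c k\<bar>)" using that by (intro sum_mono2) auto
    finally show ?thesis using N by simp
  qed
  have N1: "1 \<le> int N"
    using c[of "{}"] by simp
  have "int N * (\<Sum>k<n. u k) + (\<Sum>k<n. c k) = 0"
    unfolding div[OF order_refl] using \<Phi>' by (intro sum.neutral) auto
  then have "\<bar>int N * (\<Sum>k<n. u k)\<bar> = \<bar>\<Sum>k<n. c k\<bar>"
    by linarith
  then have "int N * \<bar>\<Sum>k<n. u k\<bar> \<le> int N - 1"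
    using c[OF order_refl] by (simp add: abs_mult)
  then have u0: "(\<Sum>k<n. u k) = 0"
    using mult_left_mono[of 1 "\<bar>\<Sum>k<n. u k\<bar>" "int N"] N1 by fastforce
  have "(\<Sum>k\<in>X. u k) \<le> (\<Sum>a\<in>\<Phi>. cut_term (\<lambda>_. 0) (\<lambda>a. int (m a)) X a)" if X: "X \<subseteq> {..<n}" for X
  proof (cases "(\<Sum>k\<in>X. u k) \<le> 0")
    case True
    also have "0 \<le> (\<Sum>a\<in>\<Phi>. cut_term (\<lambda>_. 0) (\<lambda>a. int (m a)) X a)"
      by (intro sum_nonneg) (simp add: cut_term_def)
    finally show ?thesis .
  next
    case False
    \<comment> \<open>As the sum of \<open>u\<close> over \<open>X\<close> is an integer, it is at
      least 1. Multiplying it by \<open>N\<close> then gains at least \<open>N - 1\<close>, which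
      absorbs the sum of \<open>c\<close>.\<close>
    then have "0 \<le> (int N - 1) * ((\<Sum>k\<in>X. u k) - 1)"
      using N1 by (intro mult_nonneg_nonneg) auto
    then have "(\<Sum>k\<in>X. u k) \<le> int N * (\<Sum>k\<in>X. u k) + (\<Sum>k\<in>X. c k)"
      using c[OF X] by (simp add: algebra_simps)
    also have "\<dots> \<le> (\<Sum>a\<in>\<Phi>. cut_term (\<lambda>_. 0) (\<lambda>a. int (m a)) X a)"
      unfolding div[OF X] by (intro sum_mono) (auto simp: cut_term_def)
    finally show ?thesis .
  qed
  then obtain f where f: "\<forall>a\<in>\<Phi>. 0 \<le> f a" "\<forall>k<n. (\<Sum>a\<in>\<Phi>. f a * root_vector a k) = u k"
    using hoffman_circulation[OF \<Phi>' _ u0, of "\<lambda>_. 0" "\<lambda>a. int (m a)"] by auto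
  then have "(\<lambda>a. if a \<in> \<Phi> then nat (f a) else 0) \<in> vector_partitions n \<Phi> u"
    by (auto simp: mem_vector_partitions_iff cong: sum.cong)
  with empty show False by simp
qed

section \<open>Rationality of the stretched series\<close>

text \<open>\<open>fps_X\<close> plays the role of \<open>t\<close> and \<open>monom 1 s\<close>
  that of \<open>q\<close> to the power \<open>s\<close>. Factors may repeat, hence a
  multiset.\<close>

definition denom :: "nat multiset \<Rightarrow> int poly fps" where
  "denom S = (\<Prod>s\<in>#S. 1 - fps_const (monom 1 s) * fps_X)"

text \<open>Phrased without division, since the coefficient ring \<open>int poly\<close> is not a
  field.\<close>

definition rational_series :: "int poly fps \<Rightarrow> bool" where
  "rational_series F \<longleftrightarrow> (\<exists>S P. F * denom S = fps_of_poly P)"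

lemma denom_union: "denom (S + T) = denom S * denom T"
  by (simp add: denom_def)

lemma denom_nth_0: "fps_nth (denom S) 0 = 1"
  by (induction S) (simp_all add: denom_def fps_mult_nth_0)

text \<open>Needed to bring sums to a common denominator: each numerator is multiplied by the other
  denominator and must stay a polynomial.\<close>

lemma fps_of_poly_denom: "\<exists>D. denom S = fps_of_poly D"
proof (induction S)
  case empty
  show ?case by (auto simp: denom_def intro!: exI[of _ 1])
next
  case (add s S)
  then obtain D where "denom S = fps_of_poly D" by blast
  then have "denom (add_mset s S) = fps_of_poly ((1 - [:0, monom 1 s:]) * D)"
    by (simp add: denom_def fps_of_poly_mult fps_of_poly_diff fps_of_poly_pCons)
  then show ?case by blast
qed

lemma rational_series_fps_of_poly: "rational_series (fps_of_poly P)"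
  unfolding rational_series_def by (rule exI[of _ "{#}"]) (auto simp: denom_def)

lemma rational_series_add:
  assumes "rational_series F" "rational_series G"
  shows "rational_series (F + G)"
proof -
  from assms obtain S P T Q where
    "F * denom S = fps_of_poly P" "G * denom T = fps_of_poly Q"
    by (auto simp: rational_series_def)
  moreover obtain D E where "denom S = fps_of_poly D" "denom T = fps_of_poly E"
    using fps_of_poly_denom by metis
  moreover have "(F + G) * denom (S + T) = F * denom S * denom T + G * denom T * denom S"
    by (simp add: denom_union algebra_simps)
  ultimately have "(F + G) * denom (S + T) = fps_of_poly (P * E + Q * D)"
    by (simp add: fps_of_poly_mult fps_of_poly_add)
  then show ?thesis unfolding rational_series_def by blast
qed

lemma rational_series_mult_poly:
  assumes "rational_series F"
  shows "rational_series (fps_of_poly P * F)"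
proof -
  from assms obtain S Q where "F * denom S = fps_of_poly Q"
    by (auto simp: rational_series_def)
  then have "(fps_of_poly P * F) * denom S = fps_of_poly (P * Q)"
    by (simp add: fps_of_poly_mult mult.assoc)
  then show ?thesis unfolding rational_series_def by blast
qed

lemma rational_series_mult_const:
  "rational_series F \<Longrightarrow> rational_series (fps_const p * F)"
  using rational_series_mult_poly[of F "[:p:]"] by (simp add: fps_of_poly_const)

lemma rational_series_sum:
  assumes "\<And>x. x \<in> A \<Longrightarrow> rational_series (F x)"
  shows "rational_series (\<Sum>x\<in>A. F x)"
  using assms rational_series_fps_of_poly[of 0]
  by (induction A rule: infinite_finite_induct) (auto intro: rational_series_add)

lemma rational_series_divide_factor:
  assumes "rational_series ((1 - fps_const (monom 1 s) * fps_X) * F)"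
  shows "rational_series F"
proof -
  from assms obtain S P where "(1 - fps_const (monom 1 s) * fps_X) * F * denom S = fps_of_poly P"
    by (auto simp: rational_series_def)
  then have "F * denom (add_mset s S) = fps_of_poly P"
    by (simp add: denom_def mult_ac)
  then show ?thesis unfolding rational_series_def by blast
qed

lemma rational_series_eventually_0:
  assumes "\<And>N. k \<le> N \<Longrightarrow> fps_nth F N = 0"
  shows "rational_series F"
proof -
  have "F = fps_of_poly (Poly (map (fps_nth F) [0..<k]))"
    using assms by (intro fps_ext) (auto simp: nth_default_def)
  then show ?thesis
    using rational_series_fps_of_poly by metis
qed

section \<open>Partition functions along a ray\<close>

definition kostant_series ::
    "nat \<Rightarrow> (nat \<times> nat) set \<Rightarrow> (nat \<Rightarrow> int) \<Rightarrow> (nat \<Rightarrow> int) \<Rightarrow> int poly fps" where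
  "kostant_series n \<Phi> u c = Abs_fps (\<lambda>N. q_kostant n \<Phi> (\<lambda>k. int N * u k + c k))"

lemma kostant_series_remove_root:
  assumes "\<Phi> \<subseteq> {(i, j). i < j \<and> j < n}" "a \<in> \<Phi>"
  shows "kostant_series n \<Phi> u c
       = fps_const (monom 1 1) * kostant_series n \<Phi> u (\<lambda>k. c k - root_vector a k)
         + kostant_series n (\<Phi> - {a}) u c"
proof (rule fps_ext)
  fix N
  show "fps_nth (kostant_series n \<Phi> u c) N
      = fps_nth (fps_const (monom 1 1) * kostant_series n \<Phi> u (\<lambda>k. c k - root_vector a k)
          + kostant_series n (\<Phi> - {a}) u c) N"
    using q_kostant_remove_root[OF assms, of "\<lambda>k. int N * u k + c k"]
    by (simp add: kostant_series_def add_diff_eq)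
qed

text \<open>Induction on the number of parts of \<open>g\<close>, an arbitrary family here. The
  shift \<open>c\<close> is generalised because each removed part changes it.\<close>

lemma rational_series_kostant_shift:
  assumes \<Phi>: "\<Phi> \<subseteq> {(i, j). i < j \<and> j < n}"
    and rat: "\<And>a c. a \<in> \<Phi> \<Longrightarrow> rational_series (kostant_series n (\<Phi> - {a}) u c)"
  shows "rational_series (kostant_series n \<Phi> u c
           - fps_const (monom 1 (\<Sum>a\<in>\<Phi>. g a))
             * kostant_series n \<Phi> u (\<lambda>k. c k - (\<Sum>a\<in>\<Phi>. int (g a) * root_vector a k)))"
proof (induction "\<Sum>a\<in>\<Phi>. g a" arbitrary: g c)
  case 0
  have fin: "finite \<Phi>"
    by (rule finite_subset[of _ "{..<n} \<times> {..<n}"]) (use \<Phi> in auto)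
  have "\<forall>a\<in>\<Phi>. g a = 0" using 0 fin by simp
  then show ?case
    using rational_series_fps_of_poly[of 0] by (simp add: monom_0 flip: one_pCons)
next
  case (Suc s)
  have fin: "finite \<Phi>"
    by (rule finite_subset[of _ "{..<n} \<times> {..<n}"]) (use \<Phi> in auto)
  obtain a where a: "a \<in> \<Phi>" "0 < g a"
    using Suc.hyps(2) by (metis gr0I nat.distinct(1) sum.neutral)
  define h where "h = g(a := g a - 1)"
  define c' where "c' = (\<lambda>k. c k - root_vector a k)"
  have "(\<Sum>x\<in>\<Phi>. g x) = Suc (\<Sum>x\<in>\<Phi>. h x)"
    using a by (simp add: sum.remove[OF fin a(1)] h_def)
  then have h: "s = (\<Sum>x\<in>\<Phi>. h x)"
    using Suc.hyps(2) by simp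
  have "(\<Sum>x\<in>\<Phi>. int (h x) * root_vector x k) = (\<Sum>x\<in>\<Phi>. int (g x) * root_vector x k) - root_vector a k" for k
    unfolding h_def using a by (subst sum_fun_upd_int[OF fin a(1)]) (simp add: of_nat_diff algebra_simps)
  then have c': "(\<lambda>k. c' k - (\<Sum>x\<in>\<Phi>. int (h x) * root_vector x k))
      = (\<lambda>k. c k - (\<Sum>x\<in>\<Phi>. int (g x) * root_vector x k))"
    by (simp add: c'_def)
  \<comment> \<open>The hypothesis for \<open>h\<close> and \<open>c'\<close>, multiplied by
    \<open>q\<close>, plus the error series from removing one copy of \<open>a\<close>.\<close>
  have "rational_series (fps_const (monom 1 1) * (kostant_series n \<Phi> u c'
           - fps_const (monom 1 s)
             * kostant_series n \<Phi> u (\<lambda>k. c k - (\<Sum>a\<in>\<Phi>. int (g a) * root_vector a k)))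
         + kostant_series n (\<Phi> - {a}) u c)"
    using Suc.hyps(1)[OF h, of c'] rat[OF a(1), of c] unfolding h[symmetric] c'
    by (intro rational_series_add rational_series_mult_const)
  moreover have "fps_const (monom 1 1) * fps_const (monom (1::int) s) = fps_const (monom 1 (Suc s))"
    by (simp add: mult_monom)
  ultimately show ?case
    unfolding kostant_series_remove_root[OF \<Phi> a(1), of u c] Suc.hyps(2)[symmetric] c'_def
    by (simp add: right_diff_distrib mult.assoc[symmetric] add_diff_eq diff_add_eq)
qed

theorem rational_series_kostant:
  assumes "\<Phi> \<subseteq> {(i, j). i < j \<and> j < n}"
  shows "rational_series (kostant_series n \<Phi> u c)"
proof -
  have "finite \<Phi>"
    by (rule finite_subset[of _ "{..<n} \<times> {..<n}"]) (use assms in auto)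
  then show ?thesis
    using assms
  proof (induction \<Phi> arbitrary: c rule: finite_psubset_induct)
    case (psubset \<Phi>)
    note \<Phi> = psubset.prems
    show ?case
    proof (cases "vector_partitions n \<Phi> u = {}")
      case True
      have "fps_nth (kostant_series n \<Phi> u c) N = 0" if "nat (1 + (\<Sum>k<n. \<bar>c k\<bar>)) \<le> N" for N
        using vector_partitions_empty_eventually[OF \<Phi> True, of c N] that
        by (simp add: kostant_series_def q_kostant_def nat_le_iff)
      then show ?thesis
        by (rule rational_series_eventually_0)
    next
      case False
      then obtain g where g: "g \<in> vector_partitions n \<Phi> u" by blast
      let ?F = "kostant_series n \<Phi> u c" and ?s = "\<Sum>a\<in>\<Phi>. g a"
      let ?G = "kostant_series n \<Phi> u (\<lambda>k. c k - (\<Sum>a\<in>\<Phi>. int (g a) * root_vector a k))"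
      have "rational_series (kostant_series n (\<Phi> - {a}) u c)" if "a \<in> \<Phi>" for a c
        using that \<Phi> by (intro psubset.IH) auto
      then have 1: "rational_series (?F - fps_const (monom 1 ?s) * ?G)"
        by (rule rational_series_kostant_shift[OF \<Phi>])
      \<comment> \<open>On the first \<open>n\<close> coordinates the subtracted vector is
        \<open>u\<close>, so coefficient \<open>N + 1\<close> of \<open>?G\<close> is coefficient
        \<open>N\<close> of \<open>?F\<close>. Coefficient 0 of \<open>?G\<close> has no counterpart
        in \<open>?F\<close> and is kept as a constant.\<close>
      have 2: "?G = fps_const (fps_nth ?G 0) + fps_X * ?F"
      proof (rule fps_ext)
        fix N
        show "fps_nth ?G N = fps_nth (fps_const (fps_nth ?G 0) + fps_X * ?F) N"
        proof (cases N)
          case (Suc M)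
          have "q_kostant n \<Phi> (\<lambda>k. int N * u k + (c k - (\<Sum>a\<in>\<Phi>. int (g a) * root_vector a k)))
              = q_kostant n \<Phi> (\<lambda>k. int M * u k + c k)"
            using g by (intro q_kostant_cong)
              (auto simp: mem_vector_partitions_iff Suc algebra_simps)
          then show ?thesis by (simp add: kostant_series_def Suc)
        qed simp
      qed
      have "(1 - fps_const (monom 1 ?s) * fps_X) * ?F
          = (?F - fps_const (monom 1 ?s) * ?G) + fps_of_poly [:monom 1 ?s * fps_nth ?G 0:]"
        using arg_cong[OF 2, of "(*) (fps_const (monom 1 ?s))"]
        by (simp add: algebra_simps fps_of_poly_const)
      then have "rational_series ((1 - fps_const (monom 1 ?s) * fps_X) * ?F)"
        using 1 by (simp only: rational_series_add rational_series_fps_of_poly)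
      then show ?thesis
        by (rule rational_series_divide_factor)
    qed
  qed
qed

section \<open>Stretched parabolic Kostka polynomials\<close>

lemma length_rect_rows: "length (rect_rows R) = sum_list (map snd R)"
  by (induction R) (auto simp: rect_rows_def)

lemma rect_rows_stretch: "rect_rows (stretch_rects N R) = map ((*) N) (rect_rows R)"
  by (induction R) (auto simp: rect_rows_def stretch_rects_def)

lemma map_snd_stretch: "map snd (stretch_rects N R) = map snd R"
  by (auto simp: stretch_rects_def)

text \<open>The staircase contributes \<open>i - w i\<close>, independently of \<open>N\<close>, so
  each \<open>w\<close> evaluates the partition function along a ray \<open>N u + c\<close>.\<close>

lemma parabolic_kostka_stretch:
  assumes "n = sum_list (map snd R)"
  shows "parabolic_kostka (stretch_partition N l) (stretch_rects N R)
       = (\<Sum>w | w permutes {..<n}. smult (sign w)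
            (q_kostant n (block_roots (map snd R))
              (\<lambda>i. int N * (int (l (w i)) - int (rect_rows R ! i)) + (int i - int (w i)))))"
proof -
  have "q_kostant n (block_roots (map snd R))
          (\<lambda>i. (int (stretch_partition N l (w i)) + (int n - 1 - int (w i)))
             - (int (rect_rows (stretch_rects N R) ! i) + (int n - 1 - int i)))
      = q_kostant n (block_roots (map snd R))
          (\<lambda>i. int N * (int (l (w i)) - int (rect_rows R ! i)) + (int i - int (w i)))" for w
  proof (rule q_kostant_cong)
    fix i assume "i < n"
    then have "rect_rows (stretch_rects N R) ! i = N * rect_rows R ! i"
      by (simp add: rect_rows_stretch length_rect_rows assms)
    then show "(int (stretch_partition N l (w i)) + (int n - 1 - int (w i)))
          - (int (rect_rows (stretch_rects N R) ! i) + (int n - 1 - int i))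
        = int N * (int (l (w i)) - int (rect_rows R ! i)) + (int i - int (w i))"
      by (simp add: stretch_partition_def right_diff_distrib)
  qed
  then show ?thesis
    unfolding parabolic_kostka_def map_snd_stretch Let_def assms[symmetric] by simp
qed

section \<open>Constant term of the stretched series\<close>

lemma vector_partitions_weight:
  assumes "\<Phi> \<subseteq> {(i, j). i < j \<and> j < n}" "m \<in> vector_partitions n \<Phi> v"
  shows "(\<Sum>a\<in>\<Phi>. int (m a) * (int (snd a) - int (fst a))) = - (\<Sum>k<n. int k * v k)"
proof -
  \<comment> \<open>Pairing with the potential \<open>k\<close> sends each root to minus its
    height.\<close>
  have "(\<Sum>k<n. int k * v k) = (\<Sum>k<n. int k * (\<Sum>a\<in>\<Phi>. int (m a) * root_vector a k))"
    using assms(2) by (intro sum.cong) (auto simp: mem_vector_partitions_iff)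
  also have "\<dots> = (\<Sum>a\<in>\<Phi>. int (m a) * (int (fst a) - int (snd a)))"
    using assms(1) by (intro sum_mult_divergence) auto
  finally show ?thesis
    by (simp add: sum_negf[symmetric] algebra_simps)
qed

text \<open>The total height is 0 while every root has positive height, so only the empty partition
  remains.\<close>

lemma q_kostant_zero:
  assumes \<Phi>: "\<Phi> \<subseteq> {(i, j). i < j \<and> j < n}"
  shows "q_kostant n \<Phi> (\<lambda>_. 0) = 1"
proof -
  have fin: "finite \<Phi>"
    by (rule finite_subset[of _ "{..<n} \<times> {..<n}"]) (use \<Phi> in auto)
  have "m = (\<lambda>_. 0)" if m: "m \<in> vector_partitions n \<Phi> (\<lambda>_. 0)" for m
  proof
    fix a
    have "(\<Sum>a\<in>\<Phi>. int (m a) * (int (snd a) - int (fst a))) = 0"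
      using vector_partitions_weight[OF \<Phi> m] by simp
    then have "\<forall>a\<in>\<Phi>. int (m a) * (int (snd a) - int (fst a)) = 0"
      using \<Phi> by (subst (asm) sum_nonneg_eq_0_iff[OF fin]) auto
    then show "m a = 0"
      using m \<Phi> by (cases a, cases "a \<in> \<Phi>") (force simp: mem_vector_partitions_iff)+
  qed
  then have "vector_partitions n \<Phi> (\<lambda>_. 0) = {\<lambda>_. 0}"
    by (auto simp: mem_vector_partitions_iff)
  then show ?thesis
    by (simp add: q_kostant_def)
qed

text \<open>The height of \<open>i - w i\<close> is minus half the sum of \<open>(i - w i)\<close>
  squared, hence negative for \<open>w \<noteq> id\<close>, whereas vector partitions have
  nonnegative height.\<close>

lemma q_kostant_permuted_staircase:
  assumes \<Phi>: "\<Phi> \<subseteq> {(i, j). i < j \<and> j < n}" and w: "w permutes {..<n}" "w \<noteq> id"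
  shows "q_kostant n \<Phi> (\<lambda>i. int i - int (w i)) = 0"
proof -
  have False if m: "m \<in> vector_partitions n \<Phi> (\<lambda>i. int i - int (w i))" for m
  proof -
    have sq: "(\<Sum>k<n. (int (w k))\<^sup>2) = (\<Sum>k<n. (int k)\<^sup>2)"
      using sum.permute[OF w(1), of "\<lambda>k. (int k)\<^sup>2"] by (simp add: comp_def)
    have "(\<Sum>k<n. (int k - int (w k))\<^sup>2)
        = (\<Sum>k<n. (int (w k))\<^sup>2 - (int k)\<^sup>2 + 2 * (int k * (int k - int (w k))))"
      by (intro sum.cong) (auto simp: power2_eq_square algebra_simps)
    also have "\<dots> = 2 * (\<Sum>k<n. int k * (int k - int (w k)))"
      by (simp add: sum.distrib sum_subtractf sum_distrib_left sq)
    also have "\<dots> = - 2 * (\<Sum>a\<in>\<Phi>. int (m a) * (int (snd a) - int (fst a)))"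
      using vector_partitions_weight[OF \<Phi> m] by simp
    also have "\<dots> \<le> 0"
      using \<Phi> by (auto intro!: sum_nonneg)
    finally have "(\<Sum>k<n. (int k - int (w k))\<^sup>2) = 0"
      by (intro antisym sum_nonneg) auto
    then have "w k = k" if "k < n" for k
      using that by (subst (asm) sum_nonneg_eq_0_iff) auto
    then have "w = id"
      using w(1) by (intro ext) (metis id_apply lessThan_iff permutes_not_in)
    with w(2) show False ..
  qed
  then show ?thesis
    by (auto simp: q_kostant_def intro!: sum.neutral)
qed

text \<open>For \<open>N = 0\<close> only the shifts \<open>i - w i\<close> remain, so the identity
  alone contributes.\<close>

lemma parabolic_kostka_stretch_0:
  "parabolic_kostka (stretch_partition 0 l) (stretch_rects 0 R) = 1"
proof -
  define n where "n = sum_list (map snd R)"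
  have \<Phi>: "block_roots (map snd R) \<subseteq> {(i, j). i < j \<and> j < n}"
    unfolding n_def by (rule block_roots_subset)
  have "parabolic_kostka (stretch_partition 0 l) (stretch_rects 0 R)
      = (\<Sum>w | w permutes {..<n}. if w = id then 1 else 0)"
    unfolding parabolic_kostka_stretch[OF n_def]
    by (intro sum.cong)
       (auto simp: q_kostant_permuted_staircase[OF \<Phi>] q_kostant_zero[OF \<Phi>] sign_id)
  then show ?thesis
    by (simp add: finite_permutations permutes_id)
qed

theorem rational_series_parabolic_kostka:
  "rational_series (Abs_fps (\<lambda>N. parabolic_kostka (stretch_partition N l) (stretch_rects N R)))"
proof -
  define n where "n = sum_list (map snd R)"
  have \<Phi>: "block_roots (map snd R) \<subseteq> {(i, j). i < j \<and> j < n}"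
    unfolding n_def by (rule block_roots_subset)
  have "Abs_fps (\<lambda>N. parabolic_kostka (stretch_partition N l) (stretch_rects N R))
      = (\<Sum>w | w permutes {..<n}. fps_const [:sign w:]
           * kostant_series n (block_roots (map snd R))
               (\<lambda>i. int (l (w i)) - int (rect_rows R ! i)) (\<lambda>i. int i - int (w i)))"
    by (rule fps_ext) (simp add: parabolic_kostka_stretch[OF n_def] kostant_series_def fps_sum_nth)
  then show ?thesis
    using \<Phi> by (auto intro!: rational_series_sum rational_series_mult_const rational_series_kostant)
qed

section \<open>Passage to the fraction field\<close>

definition fract_fps :: "int poly fps \<Rightarrow> int poly fract fps" where
  "fract_fps F = Abs_fps (\<lambda>N. to_fract (fps_nth F N))"

lemma fract_fps_mult: "fract_fps (F * G) = fract_fps F * fract_fps G"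
  by (rule fps_ext) (simp add: fract_fps_def fps_mult_nth)

lemma fract_fps_of_poly: "fract_fps (fps_of_poly P) = fps_of_poly (map_poly to_fract P)"
  by (rule fps_ext) (simp add: fract_fps_def coeff_map_poly)

lemma fract_fps_denom:
  "fract_fps (denom S) = (\<Prod>s\<in>#S. 1 - fps_const (to_fract (monom 1 s)) * fps_X)"
proof (induction S)
  case empty
  show ?case
    by (rule fps_ext) (simp add: denom_def fract_fps_def)
next
  case (add s S)
  have "fract_fps (1 - fps_const (monom 1 s) * fps_X)
      = 1 - fps_const (to_fract (monom 1 s)) * fps_X"
    by (rule fps_ext) (simp add: fract_fps_def fps_X_def)
  with add show ?case
    by (simp add: denom_def fract_fps_mult)
qed

theorem theorem1p1:
  fixes l :: "nat \<Rightarrow> nat" and R :: "(nat \<times> nat) list"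
  assumes "is_partition l"
    and "dominant_rects R"
    and "partition_size l = rects_size R"
  shows "\<exists>(P :: int poly poly) (S :: nat multiset).
           poly (poly P 0) 0 = 1 \<and>
           Abs_fps (\<lambda>N. to_fract (parabolic_kostka (stretch_partition N l) (stretch_rects N R)))
             = fps_of_poly (map_poly to_fract P)
               / (\<Prod>s\<in>#S. 1 - fps_const (to_fract (monom 1 s)) * fps_X)"
proof -
  define F where "F = Abs_fps (\<lambda>N. parabolic_kostka (stretch_partition N l) (stretch_rects N R))"
  obtain S P where FP: "F * denom S = fps_of_poly P"
    using rational_series_parabolic_kostka[of l R] by (auto simp: rational_series_def F_def)
  \<comment> \<open>Both \<open>F\<close> and \<open>denom S\<close> have constant term 1 in
    \<open>t\<close>, so the constant term of \<open>P\<close> in \<open>t\<close> is 1 already as a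
    polynomial in \<open>q\<close>.\<close>
  have "coeff P 0 = fps_nth (F * denom S) 0"
    by (simp add: FP)
  also have "\<dots> = 1"
    by (simp add: F_def fps_mult_nth_0 denom_nth_0 parabolic_kostka_stretch_0)
  finally have "poly (poly P 0) 0 = 1"
    by (simp add: poly_0_coeff_0)
  moreover have "fps_nth (fract_fps (denom S)) 0 \<noteq> 0"
    by (simp add: fract_fps_def denom_nth_0)
  \<comment> \<open>Over the fraction field a nonzero series can be cancelled, which turns
    \<open>FP\<close> into the quotient.\<close>
  then have "fract_fps (denom S) \<noteq> 0"
    by auto
  then have "fract_fps F = fps_of_poly (map_poly to_fract P) / fract_fps (denom S)"
    unfolding fract_fps_of_poly[symmetric] FP[symmetric] fract_fps_mult
    by simp
  then have "Abs_fps (\<lambda>N. to_fract (parabolic_kostka (stretch_partition N l) (stretch_rects N R)))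
      = fps_of_poly (map_poly to_fract P)
        / (\<Prod>s\<in>#S. 1 - fps_const (to_fract (monom 1 s)) * fps_X)"
    unfolding fract_fps_denom by (simp add: F_def fract_fps_def)
  ultimately show ?thesis by blast
qed

end
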